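(* If $L$ is a finite distributive lattice with $\chi_D(Q_L)\ge 3$, then $\chi_D(L)\le |Q_L|+\chi_D(Q_L)-1$.
   Context: A point of a lattice is join-irreducible if in the Hasse diagram it has exactly one downward edge; $Q_L$ is the subposet induced by the join-irreducible points of $L$. For a finite poset $P$, a coloring is proper if comparable points get different colors and distinguishing if the only color-preserving automorphism is the identity; $\chi_D(P)$ is the least number of colors in a proper distinguishing coloring of $P$. *)

theory Defs
  imports Main
begin

definition covered_by :: "'a::order \<Rightarrow> 'a \<Rightarrow> bool" where
  "covered_by x y \<longleftrightarrow> x < y \<and> \<not> (\<exists>z. x < z \<and> z < y)"

definition join_irreducible :: "'a::lattice \<Rightarrow> bool" where
  "join_irreducible y \<longleftrightarrow> (\<exists>!x. covered_by x y)"

definition join_irreducibles :: "'a::lattice set" where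
  "join_irreducibles = {y. join_irreducible y}"

text \<open>A subposet is given by its carrier \<open>P\<close>, with the order induced from the ambient type.
  Only the values of maps and colorings on \<open>P\<close> matter.\<close>

definition poset_automorphism :: "'a::order set \<Rightarrow> ('a \<Rightarrow> 'a) \<Rightarrow> bool" where
  "poset_automorphism P f \<longleftrightarrow>
     bij_betw f P P \<and> (\<forall>x\<in>P. \<forall>y\<in>P. x \<le> y \<longleftrightarrow> f x \<le> f y)"

definition proper_coloring :: "'a::order set \<Rightarrow> ('a \<Rightarrow> nat) \<Rightarrow> bool" where
  "proper_coloring P c \<longleftrightarrow> (\<forall>x\<in>P. \<forall>y\<in>P. x < y \<longrightarrow> c x \<noteq> c y)"

definition distinguishing_coloring :: "'a::order set \<Rightarrow> ('a \<Rightarrow> nat) \<Rightarrow> bool" where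
  "distinguishing_coloring P c \<longleftrightarrow>
     (\<forall>f. poset_automorphism P f \<and> (\<forall>x\<in>P. c (f x) = c x) \<longrightarrow> (\<forall>x\<in>P. f x = x))"

text \<open>Meant for finite \<open>P\<close>: an injective coloring is proper and distinguishing, so the least
  number is attained.\<close>

definition chi_D :: "'a::order set \<Rightarrow> nat" where
  "chi_D P = (LEAST k. \<exists>c. proper_coloring P c \<and> distinguishing_coloring P c \<and> card (c ` P) = k)"

end

theory Submission
  imports Defs
begin

text \<open>Let \<open>c\<close> be an optimal coloring of \<open>Q\<^sub>L\<close> with color set \<open>C\<close>, and let the rank of \<open>x\<close> be the
  number of join-irreducibles below \<open>x\<close>; it is strictly monotone with values in \<open>{0..|Q\<^sub>L|}\<close>, and
  all points of rank 1 are join-irreducible. Coloring \<open>Q\<^sub>L\<close> by \<open>c\<close> and all other points by their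
  rank is proper and distinguishing, but it uses up to \<open>|Q\<^sub>L| + |C|\<close> colors. To save the color of
  rank 2, a point of rank 2 outside \<open>Q\<^sub>L\<close>, which lies above exactly two atoms, receives the least color
  of \<open>C\<close> not used on these atoms; this is where \<open>|C| \<ge> 3\<close> is needed. A conflict can only arise with some
  \<open>q \<in> Q\<^sub>L\<close> of rank at least 3 above it, and then \<open>c q\<close> is also the least color not used on the
  atoms below \<open>q\<close>. All such \<open>q\<close> are colored by their rank instead. Nothing is lost: \<open>c q\<close> can be
  recovered from the colors of the atoms below \<open>q\<close>.\<close>

section \<open>Bounds and witnesses for \<open>chi_D\<close>\<close>

lemma chi_D_le:
  assumes "proper_coloring P c" "distinguishing_coloring P c"
  shows "chi_D P \<le> card (c ` P)"
  unfolding chi_D_def by (rule Least_le) (use assms in blast)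

lemma chi_D_attained:
  fixes P :: "'a::order set"
  assumes "finite P"
  obtains c where "proper_coloring P c" "distinguishing_coloring P c" "card (c ` P) = chi_D P"
proof -
  obtain c :: "'a \<Rightarrow> nat" where c: "inj_on c P"
    using finite_imp_inj_to_nat_seg[OF assms] by blast
  have "proper_coloring P c"
    using c by (auto simp: proper_coloring_def inj_on_def)
  moreover have "distinguishing_coloring P c"
    unfolding distinguishing_coloring_def poset_automorphism_def
    using c by (auto dest: bij_betwE inj_onD)
  ultimately have "\<exists>k c. proper_coloring P c \<and> distinguishing_coloring P c \<and> card (c ` P) = k"
    by blast
  from LeastI_ex[OF this] show ?thesis
    using that unfolding chi_D_def by blast
qed

section \<open>Join-irreducibles below a point and the rank\<close>

lemma exists_covered_by_between:
  fixes x z :: "'a::{finite, order}"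
  assumes "x < z"
  obtains y where "x \<le> y" "covered_by y z"
proof -
  obtain y where y: "y \<in> {y. x \<le> y \<and> y < z}" "\<forall>b\<in>{y. x \<le> y \<and> y < z}. y \<le> b \<longrightarrow> y = b"
    using finite_has_maximal[of "{y. x \<le> y \<and> y < z}"] assms by auto
  have False if "y < w" "w < z" for w
    using y that by (metis (mono_tags, lifting) mem_Collect_eq order.strict_iff_order order_trans)
  with y have "covered_by y z"
    unfolding covered_by_def by blast
  with y that show ?thesis by blast
qed

text \<open>A minimal \<open>z\<close> among the points below \<open>y\<close> but not below
  \<open>x\<close> works: all points strictly under \<open>z\<close> lie below \<open>x\<close>, so
  the join of two distinct lower covers lies below \<open>x\<close> too. It then differs from
  \<open>z\<close>, against covering.\<close>

lemma exists_join_irreducible_below: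
  fixes x y :: "'a::{finite, lattice}"
  assumes "\<not> y \<le> x"
  obtains q where "q \<in> join_irreducibles" "q \<le> y" "\<not> q \<le> x"
proof -
  obtain z where z: "z \<in> {z. z \<le> y \<and> \<not> z \<le> x}" "\<forall>b\<in>{z. z \<le> y \<and> \<not> z \<le> x}. b \<le> z \<longrightarrow> z = b"
    using finite_has_minimal[of "{z. z \<le> y \<and> \<not> z \<le> x}"] assms by auto
  have below: "w \<le> x" if "w < z" for w
    using z that by (metis (mono_tags, lifting) mem_Collect_eq order.strict_iff_order order_trans)
  \<comment> \<open>This only supplies some point strictly below \<open>z\<close>, so that
    \<open>z\<close> has a lower cover at all.\<close>
  have "inf z x < z"
    using z by (metis (mono_tags, lifting) inf.cobounded1 inf.cobounded2 mem_Collect_eq order.strict_iff_order)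
  then obtain u where u: "covered_by u z"
    by (rule exists_covered_by_between)
  have "v = u" if v: "covered_by v z" for v
  proof (rule ccontr)
    assume "v \<noteq> u"
    have lt: "u < z" "v < z" using u v by (auto simp: covered_by_def)
    then have "sup u v \<noteq> z" using z below by fastforce
    then have "sup u v < z" using lt by (simp add: order.strict_iff_order)
    then have "u = sup u v" "v = sup u v"
      using u v unfolding covered_by_def
      by (metis sup.cobounded1 order.strict_iff_order, metis sup.cobounded2 order.strict_iff_order)
    with \<open>v \<noteq> u\<close> show False by simp
  qed
  with u have "z \<in> join_irreducibles"
    by (auto simp: join_irreducibles_def join_irreducible_def)
  with z that show ?thesis by blast
qed

definition ji_below :: "'a::{finite, lattice} \<Rightarrow> 'a set" where
  "ji_below x = {q \<in> join_irreducibles. q \<le> x}"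

definition ji_rank :: "'a::{finite, lattice} \<Rightarrow> nat" where
  "ji_rank x = card (ji_below x)"

text \<open>If \<open>x\<close> is not below \<open>y\<close>, some join-irreducible below
  \<open>x\<close> is not below \<open>y\<close>. Hence \<open>ji_below\<close> embeds the order
  into set inclusion and a point is determined by its join-irreducibles.\<close>

lemma ji_below_subset_iff: "ji_below x \<subseteq> ji_below y \<longleftrightarrow> x \<le> y"
proof
  assume sub: "ji_below x \<subseteq> ji_below y"
  show "x \<le> y"
  proof (rule ccontr)
    assume "\<not> x \<le> y"
    then obtain q where "q \<in> join_irreducibles" "q \<le> x" "\<not> q \<le> y"
      by (rule exists_join_irreducible_below)
    with sub show False by (auto simp: ji_below_def)
  qed
qed (auto simp: ji_below_def)

lemma ji_rank_strict_mono:
  assumes "x < y"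
  shows "ji_rank x < ji_rank y"
proof -
  have "ji_below x \<subset> ji_below y"
    unfolding less_le_not_le ji_below_subset_iff using assms by (simp add: less_le_not_le)
  then show ?thesis
    unfolding ji_rank_def by (intro psubset_card_mono) simp_all
qed

lemma ji_rank_le: "ji_rank (x :: 'a::{finite, lattice}) \<le> card (join_irreducibles :: 'a set)"
  unfolding ji_rank_def by (rule card_mono) (auto simp: ji_below_def)

lemma ji_rank_pos: "q \<in> join_irreducibles \<Longrightarrow> 0 < ji_rank q"
  unfolding ji_rank_def by (auto simp: card_gt_0_iff ji_below_def)

lemma join_irreducible_if_ji_rank_1:
  assumes "ji_rank x = 1"
  shows "x \<in> join_irreducibles"
proof -
  obtain q where q: "ji_below x = {q}"
    using assms unfolding ji_rank_def by (rule card_1_singletonE)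
  then have "q \<in> join_irreducibles" "q \<le> x" by (auto simp: ji_below_def)
  moreover from this have "x \<le> q"
    using q ji_below_subset_iff[of x q] by (auto simp: ji_below_def)
  ultimately show ?thesis by (simp add: order_antisym)
qed

section \<open>Automorphisms preserve join-irreducibles and rank\<close>

lemma automorphism_less_iff:
  assumes "poset_automorphism UNIV f"
  shows "f x < f y \<longleftrightarrow> x < y"
  using assms by (simp add: poset_automorphism_def less_le_not_le)

text \<open>An automorphism preserves covering in both directions, hence maps the lower covers of
  \<open>y\<close> bijectively onto those of \<open>f y\<close>, and being join-irreducible means
  having exactly one.\<close>

lemma automorphism_join_irreducible_iff:
  fixes f :: "'a::{finite, lattice} \<Rightarrow> 'a"
  assumes f: "poset_automorphism UNIV f"
  shows "f y \<in> join_irreducibles \<longleftrightarrow> y \<in> join_irreducibles"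
proof -
  have bij: "bij f" using f by (simp add: poset_automorphism_def)
  have cov: "covered_by (f x) (f y) \<longleftrightarrow> covered_by x y" for x
  proof -
    have "(\<exists>z. f x < z \<and> z < f y) \<longleftrightarrow> (\<exists>z. f x < f z \<and> f z < f y)"
      using bij_is_surj[OF bij] by (metis surjD)
    then show ?thesis
      unfolding covered_by_def automorphism_less_iff[OF f] by simp
  qed
  have "bij_betw f {x. covered_by x y} {x. covered_by x (f y)}"
    unfolding bij_betw_def
  proof
    show "inj_on f {x. covered_by x y}"
      using bij by (simp add: bij_is_inj inj_on_subset[of f UNIV])
    show "f ` {x. covered_by x y} = {x. covered_by x (f y)}"
      using bij_is_surj[OF bij] cov by (auto simp: image_iff) (metis surjD)
  qed
  then have "card {x. covered_by x (f y)} = card {x. covered_by x y}"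
    by (simp add: bij_betw_same_card)
  moreover have "(\<exists>!x. P x) \<longleftrightarrow> card {x. P x} = 1" for P :: "'a \<Rightarrow> bool"
    unfolding is_singleton_altdef[symmetric] is_singleton_def by (auto simp: set_eq_iff)
  ultimately have "(\<exists>!x. covered_by x (f y)) \<longleftrightarrow> (\<exists>!x. covered_by x y)"
    by simp
  then show ?thesis by (simp add: join_irreducibles_def join_irreducible_def)
qed

lemma automorphism_ji_below:
  assumes f: "poset_automorphism UNIV f"
  shows "ji_below (f x) = f ` ji_below x"
proof -
  have "bij f" and le: "\<And>x y. f x \<le> f y \<longleftrightarrow> x \<le> y"
    using f by (auto simp: poset_automorphism_def)
  show ?thesis
  proof (intro set_eqI iffI)
    fix q assume "q \<in> ji_below (f x)"
    moreover obtain p where "q = f p" using \<open>bij f\<close> by (metis bij_pointE)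
    ultimately show "q \<in> f ` ji_below x"
      by (auto simp: ji_below_def le automorphism_join_irreducible_iff[OF f])
  qed (auto simp: ji_below_def le automorphism_join_irreducible_iff[OF f])
qed

lemma automorphism_ji_rank:
  assumes f: "poset_automorphism UNIV f"
  shows "ji_rank (f x) = ji_rank x"
proof -
  have "inj_on f (ji_below x)"
    using f by (simp add: poset_automorphism_def bij_is_inj inj_on_subset[of f UNIV])
  then show ?thesis
    unfolding ji_rank_def automorphism_ji_below[OF f] by (rule card_image)
qed

lemma automorphism_restrict_join_irreducibles:
  fixes f :: "'a::{finite, lattice} \<Rightarrow> 'a"
  assumes f: "poset_automorphism UNIV f"
  shows "poset_automorphism join_irreducibles f"
proof -
  have "inj_on f join_irreducibles"
    using f by (simp add: poset_automorphism_def bij_is_inj inj_on_subset[of f UNIV])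
  moreover have "f ` join_irreducibles \<subseteq> join_irreducibles"
    using automorphism_join_irreducible_iff[OF f] by blast
  ultimately have "bij_betw f join_irreducibles join_irreducibles"
    by (simp add: bij_betw_def endo_inj_surj)
  then show ?thesis using f by (auto simp: poset_automorphism_def)
qed

section \<open>The lifted coloring\<close>

definition atom_colors :: "('a::{finite, lattice} \<Rightarrow> nat) \<Rightarrow> 'a \<Rightarrow> nat set" where
  "atom_colors c x = c ` {a \<in> ji_below x. ji_rank a = 1}"

text \<open>Where the value matters, \<open>Min\<close> is taken over a nonempty set: for rank 2
  this is \<open>first_free_in\<close>, and for a join-irreducible of rank at least 3 and a proper
  \<open>c\<close> the set contains the point's own color.\<close>

definition first_free :: "('a::{finite, lattice} \<Rightarrow> nat) \<Rightarrow> 'a \<Rightarrow> nat" where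
  "first_free c x = Min (c ` join_irreducibles - atom_colors c x)"

text \<open>For a join-irreducible, the condition does not ask whether a conflicting point of rank 2
  exists. It can thus force the value of \<open>c\<close> from the atoms alone.\<close>

definition rank_colored :: "('a::{finite, lattice} \<Rightarrow> nat) \<Rightarrow> 'a \<Rightarrow> bool" where
  "rank_colored c x \<longleftrightarrow>
     (if x \<in> join_irreducibles then 3 \<le> ji_rank x \<and> c x = first_free c x else ji_rank x \<noteq> 2)"

text \<open>The summand \<open>Suc (Max \<dots>)\<close> keeps the rank colors disjoint from those of \<open>c\<close>.\<close>

definition lift_coloring :: "('a::{finite, lattice} \<Rightarrow> nat) \<Rightarrow> 'a \<Rightarrow> nat" where
  "lift_coloring c x =
     (if rank_colored c x then Suc (Max (c ` join_irreducibles)) + ji_rank x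
      else if x \<in> join_irreducibles then c x else first_free c x)"

lemma atom_colors_mono: "x \<le> y \<Longrightarrow> atom_colors c x \<subseteq> atom_colors c y"
  unfolding atom_colors_def using ji_below_subset_iff[of x y] by blast

lemma color_notin_atom_colors:
  assumes "proper_coloring join_irreducibles c" "q \<in> join_irreducibles" "ji_rank q \<noteq> 1"
  shows "c q \<notin> atom_colors c q"
proof
  assume "c q \<in> atom_colors c q"
  then obtain a where a: "a \<in> join_irreducibles" "a \<le> q" "ji_rank a = 1" "c q = c a"
    by (auto simp: atom_colors_def ji_below_def)
  with assms(3) have "a < q" by (auto simp: order.strict_iff_order)
  with a assms show False by (metis proper_coloring_def)
qed

text \<open>The ranks 1 and 2 never serve as colors, which leaves one rank color fewer than there
  are join-irreducibles.\<close>

lemma rank_coloredD: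
  assumes "rank_colored c x"
  shows "ji_rank x = 0 \<or> 3 \<le> ji_rank x"
proof (cases "x \<in> join_irreducibles")
  case True
  with assms show ?thesis by (simp add: rank_colored_def)
next
  case False
  with assms have "ji_rank x \<noteq> 2" by (simp add: rank_colored_def)
  moreover have "ji_rank x \<noteq> 1" using False join_irreducible_if_ji_rank_1 by blast
  ultimately show ?thesis by linarith
qed

section \<open>The lifted coloring is proper, distinguishing and small\<close>

locale join_irreducible_coloring =
  fixes c :: "'a::{finite, lattice} \<Rightarrow> nat"
  assumes proper: "proper_coloring join_irreducibles c"
    and distinguishing: "distinguishing_coloring join_irreducibles c"
    and three_colors: "3 \<le> card (c ` join_irreducibles)"
begin

text \<open>At most two atoms lie below \<open>x\<close>, so they cannot use up three
  colors.\<close>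

lemma first_free_in:
  assumes "ji_rank x = 2"
  shows "first_free c x \<in> c ` join_irreducibles - atom_colors c x"
proof -
  have "card (atom_colors c x) \<le> card {a \<in> ji_below x. ji_rank a = 1}"
    unfolding atom_colors_def by (rule card_image_le) simp
  also have "\<dots> \<le> ji_rank x"
    unfolding ji_rank_def by (rule card_mono) auto
  finally have "card (atom_colors c x) < card (c ` join_irreducibles)"
    using assms three_colors by simp
  moreover have "finite (atom_colors c x)"
    by (simp add: atom_colors_def)
  ultimately have "c ` join_irreducibles - atom_colors c x \<noteq> {}"
    using card_mono[of "atom_colors c x" "c ` join_irreducibles"] by auto
  then show ?thesis
    unfolding first_free_def by (intro Min_in) auto
qed

lemma lift_coloring_in:
  assumes "\<not> rank_colored c x"
  shows "lift_coloring c x \<in> c ` join_irreducibles"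
  using assms first_free_in[of x] by (auto simp: lift_coloring_def rank_colored_def)

text \<open>The color alone reveals whether it is a rank color, so color-preserving maps respect
  \<open>rank_colored\<close>.\<close>

lemma lift_coloring_le_iff:
  "lift_coloring c x \<le> Max (c ` join_irreducibles) \<longleftrightarrow> \<not> rank_colored c x"
  using lift_coloring_in[of x] by (auto simp: lift_coloring_def)

lemma lift_coloring_proper: "proper_coloring UNIV (lift_coloring c)"
  unfolding proper_coloring_def
proof (intro ballI impI notI)
  fix x y :: 'a
  assume "x < y" and eq: "lift_coloring c x = lift_coloring c y"
  have rank: "ji_rank x < ji_rank y" using \<open>x < y\<close> by (rule ji_rank_strict_mono)
  have "rank_colored c x \<longleftrightarrow> rank_colored c y"
    using eq lift_coloring_le_iff by metis
  with eq rank have nx: "\<not> rank_colored c x" and ny: "\<not> rank_colored c y"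
    by (auto simp: lift_coloring_def)
  show False
  proof (cases "x \<in> join_irreducibles")
    case x: True
    then have lx: "lift_coloring c x = c x" using nx by (simp add: lift_coloring_def)
    show False
    proof (cases "y \<in> join_irreducibles")
      case True
      then have "c x = c y" using eq lx ny by (simp add: lift_coloring_def)
      with x True \<open>x < y\<close> proper show False by (auto simp: proper_coloring_def)
    next
      case False
      with ny have "ji_rank y = 2" by (auto simp: rank_colored_def)
      \<comment> \<open>Now \<open>x\<close> is an atom below \<open>y\<close>, and
        \<open>first_free\<close> avoids the colors of these.\<close>
      with rank ji_rank_pos[OF x] have "ji_rank x = 1" by simp
      then have "c x \<in> atom_colors c y"
        using x \<open>x < y\<close> by (auto simp: atom_colors_def ji_below_def)
      moreover have "c x = first_free c y"
        using eq lx ny False by (simp add: lift_coloring_def)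
      ultimately show False using first_free_in[OF \<open>ji_rank y = 2\<close>] by simp
    qed
  next
    case x: False
    with nx have x2: "ji_rank x = 2" and lx: "lift_coloring c x = first_free c x"
      by (auto simp: rank_colored_def lift_coloring_def)
    have y: "y \<in> join_irreducibles" using ny rank x2 by (auto simp: rank_colored_def split: if_splits)
    then have cy: "c y = first_free c x" using eq lx ny by (simp add: lift_coloring_def)
    have free: "c y \<in> c ` join_irreducibles - atom_colors c y"
      using color_notin_atom_colors[OF proper y] y rank x2 by auto
    \<comment> \<open>The color \<open>c y\<close> is least among those free for \<open>x\<close>.
      Fewer colors are free for \<open>y\<close>, but \<open>c y\<close> is still one of them and so
      remains the least. Then \<open>y\<close> would be colored by its rank.\<close>
    have "first_free c y = c y"
    proof (rule order_antisym)
      show "first_free c y \<le> c y"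
        unfolding first_free_def by (rule Min_le) (use free in auto)
      have "atom_colors c x \<subseteq> atom_colors c y"
        using \<open>x < y\<close> by (intro atom_colors_mono) simp
      then show "c y \<le> first_free c y"
        unfolding cy unfolding first_free_def by (intro Min_antimono) (use free in auto)
    qed
    with ny y rank x2 show False by (simp add: rank_colored_def)
  qed
qed

lemma lift_coloring_distinguishing: "distinguishing_coloring UNIV (lift_coloring c)"
  unfolding distinguishing_coloring_def
proof (intro allI impI, elim conjE)
  fix f :: "'a \<Rightarrow> 'a"
  assume f: "poset_automorphism UNIV f"
    and pres: "\<forall>x\<in>UNIV. lift_coloring c (f x) = lift_coloring c x"
  note [simp] = automorphism_join_irreducible_iff[OF f] automorphism_ji_rank[OF f]
  have ranked: "rank_colored c (f x) \<longleftrightarrow> rank_colored c x" for x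
    using pres lift_coloring_le_iff by (metis UNIV_I)
  have unranked: "c (f q) = c q" if "q \<in> join_irreducibles" "\<not> rank_colored c q" for q
    using pres[rule_format, of q] that ranked[of q] by (simp add: lift_coloring_def)
  have "{a \<in> ji_below (f x). ji_rank a = 1} = f ` {a \<in> ji_below x. ji_rank a = 1}" for x
    by (auto simp: automorphism_ji_below[OF f])
  moreover have "c (f a) = c a" if "a \<in> ji_below x" "ji_rank a = 1" for a x
    using that by (intro unranked) (auto simp: ji_below_def dest: rank_coloredD)
  ultimately have "atom_colors c (f x) = atom_colors c x" for x
    unfolding atom_colors_def by (auto simp: image_image intro!: image_cong)
  then have first_free: "first_free c (f x) = first_free c x" for x
    by (simp add: first_free_def)
  have "c (f q) = c q" if "q \<in> join_irreducibles" for q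
  proof (cases "rank_colored c q")
    case True
    \<comment> \<open>Both \<open>q\<close> and \<open>f q\<close> carry their first free color
      under \<open>c\<close>, and these agree.\<close>
    with ranked[of q] that first_free[of q] show ?thesis by (simp add: rank_colored_def)
  qed (use that unranked in blast)
  then have fix_ji: "f q = q" if "q \<in> join_irreducibles" for q
    using distinguishing automorphism_restrict_join_irreducibles[OF f] that
    by (auto simp: distinguishing_coloring_def)
  show "\<forall>x\<in>UNIV. f x = x"
  proof
    fix x
    have "f ` ji_below x = ji_below x"
      using fix_ji by (auto simp: ji_below_def image_iff)
    then have "ji_below (f x) = ji_below x"
      by (simp add: automorphism_ji_below[OF f])
    then show "f x = x"
      using ji_below_subset_iff[of x "f x"] ji_below_subset_iff[of "f x" x]
      by (simp add: order_antisym)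
  qed
qed

lemma card_lift_coloring:
  "card (range (lift_coloring c))
     \<le> card (join_irreducibles :: 'a set) + card (c ` join_irreducibles) - 1"
proof -
  let ?n = "card (join_irreducibles :: 'a set)"
  let ?C = "c ` join_irreducibles"
  let ?R = "insert 0 {3..?n}"
  have n: "3 \<le> ?n"
    using three_colors card_image_le[of "join_irreducibles :: 'a set" c] by simp
  have "lift_coloring c x \<in> ?C \<union> (+) (Suc (Max ?C)) ` ?R" for x
  proof (cases "rank_colored c x")
    case True
    then have "ji_rank x \<in> ?R" using rank_coloredD[of c x] ji_rank_le[of x] by auto
    moreover have "lift_coloring c x = Suc (Max ?C) + ji_rank x"
      using True by (simp add: lift_coloring_def)
    ultimately show ?thesis by blast
  qed (use lift_coloring_in in blast)
  then have "card (range (lift_coloring c)) \<le> card (?C \<union> (+) (Suc (Max ?C)) ` ?R)"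
    by (intro card_mono) auto
  also have "\<dots> \<le> card ?C + card ((+) (Suc (Max ?C)) ` ?R)"
    by (rule card_Un_le)
  also have "\<dots> \<le> card ?C + card ?R"
    by (intro add_left_mono card_image_le) simp
  \<comment> \<open>Here \<open>n\<close> keeps the subtraction in the cardinality of
    \<open>{3..?n}\<close> from being truncated.\<close>
  also have "\<dots> = ?n + card ?C - 1" using n by simp
  finally show ?thesis .
qed

end

theorem theorem4p7:
  assumes "chi_D (join_irreducibles :: 'a::{finite, distrib_lattice} set) \<ge> 3"
  shows "chi_D (UNIV :: 'a set)
           \<le> card (join_irreducibles :: 'a set) + chi_D (join_irreducibles :: 'a set) - 1"
proof -
  obtain c :: "'a \<Rightarrow> nat" where c: "proper_coloring join_irreducibles c"
    "distinguishing_coloring join_irreducibles c"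
    "card (c ` join_irreducibles) = chi_D (join_irreducibles :: 'a set)"
    using chi_D_attained[of "join_irreducibles :: 'a set"] by auto
  then interpret join_irreducible_coloring c
    using assms by unfold_locales auto
  show ?thesis
    using chi_D_le[OF lift_coloring_proper lift_coloring_distinguishing] card_lift_coloring c(3)
    by simp
qed

end
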